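(* Let $J_3:\mathbb{N}\to\mathbb{N}$ be the Josephus function with reduction constant $3$, let $\{n_p^{(\ell)}\}_{\ell\in\mathbb{N}}$ be the strictly increasing enumeration of the fixed points of $J_3$ (so $n_p^{(1)}=1$), and for each $\ell$ let $\overline{m}_\ell$ be the number of pure high extremal points $n$ of $J_3$ with $n_p^{(\ell)}<n<n_p^{(\ell+1)}$. Fix $\ell\in\mathbb{N}$ and an integer $n$ with $n_p^{(\ell)}+1\le n\le n_p^{(\ell+1)}$, and define \[ \mathfrak{m}:=\left\lceil \log_{3/2}\left(\frac{2n+1}{3n_p^{(\ell)}+2}\right)\right\rceil . \] Then \[ J_3(n)=3n+1-\left(\frac{2}{3}\right)^{\overline{m}_\ell-\mathfrak{m}}\left(2n_p^{(\ell+1)}+1\right). \]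
   Context: The Josephus function $J_3$: for $n\in\mathbb{N}=\{1,2,\dots\}$, place $n$ people numbered $1,\dots,n$ clockwise in a circle; starting the count at person $1$ and proceeding clockwise, eliminate every third person (the first eliminated is person $3$), the circle closing ranks after each elimination, until one person remains; $J_3(n)$ is the original number of the survivor. Equivalently $J_3(1)=1$ and $J_3(n)=((J_3(n-1)+2)\bmod n)+1$ for $n\ge 2$. A positive integer $n$ is a fixed point of $J_3$ if $J_3(n)=n$, and a pure high extremal point if $J_3(n)=n-1$. (It is known that $J_3$ has infinitely many fixed points.) *)

theory Defs
  imports Complex_Main "HOL-Library.Infinite_Set"
begin

text \<open>The circle is a list read clockwise whose head is the person at whom the count (re)starts, so
  the \<open>k\<close>-th person counted is the head after rotating by \<open>k - 1\<close>. Rotation wraps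
  around, also when fewer than \<open>k\<close> people are left.\<close>

definition eliminate :: "nat \<Rightarrow> 'a list \<Rightarrow> 'a list" where
  "eliminate k xs = tl (rotate (k - 1) xs)"

definition josephus :: "nat \<Rightarrow> nat \<Rightarrow> nat" where
  "josephus k n = hd ((eliminate k ^^ (n - 1)) [1..<Suc n])"

definition fixed_points :: "nat \<Rightarrow> nat set" where
  "fixed_points k = {n. 1 \<le> n \<and> josephus k n = n}"

definition pure_high_extremal_points :: "nat \<Rightarrow> nat set" where
  "pure_high_extremal_points k = {n. 1 \<le> n \<and> josephus k n = n - 1}"

text \<open>Indexed from 1, whereas \<^const>\<open>enumerate\<close> is indexed from 0. The set
  of fixed points is infinite for \<open>k = 3\<close>, see \<open>infinite_fixed_points_3\<close> below.\<close>

definition fixed_point_seq :: "nat \<Rightarrow> nat \<Rightarrow> nat" where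
  "fixed_point_seq k l = enumerate (fixed_points k) (l - 1)"

definition num_pure_high :: "nat \<Rightarrow> nat \<Rightarrow> nat" where
  "num_pure_high k l = card {n \<in> pure_high_extremal_points k.
     fixed_point_seq k l < n \<and> n < fixed_point_seq k (l + 1)}"

lemma eliminate_map: "eliminate k (map f xs) = map f (eliminate k xs)"
  by (simp add: eliminate_def rotate_map map_tl)

lemma length_eliminate: "length (eliminate k xs) = length xs - 1"
  by (simp add: eliminate_def)

lemma eliminate_pow_map: "(eliminate k ^^ m) (map f xs) = map f ((eliminate k ^^ m) xs)"
  by (induction m) (simp_all add: eliminate_map)

lemma length_eliminate_pow: "length ((eliminate k ^^ m) xs) = length xs - m"
  by (induction m) (simp_all add: length_eliminate)

lemma josephus_1: "josephus k 1 = 1"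
  by (simp add: josephus_def)

lemma josephus_rec:
  assumes "1 \<le> k" "2 \<le> n"
  shows "josephus k n = (josephus k (n - 1) + (k - 1)) mod n + 1"
proof -
  define f where "f j = (j + (k - 1)) mod n + 1" for j
  have el: "eliminate k [1..<Suc n] = map f [1..<n]"
  proof (rule nth_equalityI)
    show "length (eliminate k [1..<Suc n]) = length (map f [1..<n])"
      by (simp add: length_eliminate)
  next
    fix i assume "i < length (eliminate k [1..<Suc n])"
    then have i: "Suc i < n" by (simp add: length_eliminate del: upt_Suc)
    have "eliminate k [1..<Suc n] ! i = rotate (k - 1) [1..<Suc n] ! Suc i"
      using i by (simp add: eliminate_def nth_tl del: upt_Suc)
    also have "\<dots> = [1..<Suc n] ! ((k - 1 + Suc i) mod n)"
      using i by (subst nth_rotate) (simp_all del: upt_Suc)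
    also have "\<dots> = 1 + (k - 1 + Suc i) mod n"
    proof -
      have "(k - 1 + Suc i) mod n < n" using assms by simp
      then show ?thesis by (subst nth_upt) simp_all
    qed
    also have "\<dots> = map f [1..<n] ! i"
      using i by (simp add: f_def add.commute)
    finally show "eliminate k [1..<Suc n] ! i = map f [1..<n] ! i" .
  qed
  obtain m where m: "n = Suc (Suc m)"
    using assms by (metis Suc_le_D numeral_2_eq_2 Suc_le_mono)
  have "(eliminate k ^^ (n - 1)) [1..<Suc n] = (eliminate k ^^ m) (eliminate k [1..<Suc n])"
    by (simp add: m funpow_swap1 del: upt_Suc)
  also have "\<dots> = map f ((eliminate k ^^ m) [1..<n])"
    by (simp only: el eliminate_pow_map)
  finally have "josephus k n = hd (map f ((eliminate k ^^ m) [1..<n]))"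
    by (simp add: josephus_def)
  moreover have "(eliminate k ^^ m) [1..<n] \<noteq> []"
    using length_eliminate_pow[of m k "[1..<n]"] by (auto simp: m simp del: upt_Suc)
  moreover have "josephus k (n - 1) = hd ((eliminate k ^^ m) [1..<n])"
    by (simp add: josephus_def m)
  ultimately show ?thesis
    by (simp add: hd_map f_def)
qed

lemma josephus_bounds:
  assumes "1 \<le> k" "1 \<le> n"
  shows "1 \<le> josephus k n \<and> josephus k n \<le> n"
proof (cases "n = 1")
  case True
  then show ?thesis using josephus_1[of k] by simp
next
  case False
  then have "(josephus k (n - 1) + (k - 1)) mod n < n" using assms by simp
  then show ?thesis using josephus_rec[of k n] assms False by linarith
qed

lemma infinite_fixed_points_3: "infinite (fixed_points 3)"
proof
  assume "finite (fixed_points 3)"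
  then obtain N where N: "\<And>n. n \<in> fixed_points 3 \<Longrightarrow> n \<le> N"
    by (meson finite_nat_set_iff_bounded_le)
  define g where "g n = 3 * n + 1 - josephus 3 n" for n
  have lt: "josephus 3 n < n" if "n > N" for n
    using N[of n] josephus_bounds[of 3 n] that by (force simp: fixed_points_def)
  have rec: "josephus 3 (Suc n) = (josephus 3 n + 2) mod (Suc n) + 1" if "n > N" for n
    using josephus_rec[of 3 "Suc n"] that by simp
  have dvd: "\<forall>n>N. 2 ^ t dvd g n" for t
  proof (induction t)
    case 0
    show ?case by simp
  next
    case (Suc t)
    have "2 ^ Suc t dvd g n" if "n > N" for n
      using that
    proof (induction "n - josephus 3 n" arbitrary: n rule: less_induct)
      case less
      show ?case
      proof (cases "josephus 3 n + 1 = n")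
        case True
        then have eq: "josephus 3 n + 2 = Suc n" by simp
        have "josephus 3 (Suc n) = 1"
          unfolding rec[OF less.prems] eq by simp
        then have "g (Suc n) = 3 * (n + 1)" by (simp add: g_def)
        moreover have "2 ^ t dvd g (Suc n)" using Suc less.prems by simp
        ultimately have "2 ^ t dvd 3 * (n + 1)" by simp
        moreover have "coprime (2 ^ t) (3 :: nat)" by simp
        ultimately have "2 ^ t dvd n + 1"
          using coprime_dvd_mult_right_iff by blast
        moreover have "g n = 2 * (n + 1)" using True by (simp add: g_def)
        ultimately show ?thesis by (simp only: power_Suc mult_dvd_mono dvd_refl)
      next
        case False
        with lt[OF less.prems] have le: "josephus 3 n + 2 \<le> n" by simp
        then have J: "josephus 3 (Suc n) = josephus 3 n + 3"
          unfolding rec[OF less.prems] by simp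
        then have "g (Suc n) = g n" by (simp add: g_def)
        moreover have "2 ^ Suc t dvd g (Suc n)"
          by (rule less.hyps) (use J le less.prems in simp_all)
        ultimately show ?thesis by simp
      qed
    qed
    then show ?case by blast
  qed
  have "g (Suc N) > 0" using lt[of "Suc N"] by (simp add: g_def)
  moreover have "2 ^ g (Suc N) dvd g (Suc N)" using dvd by blast
  ultimately have "2 ^ g (Suc N) \<le> g (Suc N)" by (rule dvd_imp_le[rotated])
  moreover have "g (Suc N) < 2 ^ g (Suc N)" by (rule less_exp)
  ultimately show False by simp
qed

end

theory Submission imports Defs begin

text \<open>Put \<open>g n = 3 * n + 1 - J\<^sub>3 n\<close>. Past a fixed point \<open>F\<close> we have \<open>g (F + 1) = 3 * F + 2\<close>, and up to the next
  fixed point \<open>g\<close> is constant except that it is multiplied by \<open>3 / 2\<close> after each pure high extremal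
  point. So \<open>g n = (3 / 2) ^ c * (3 * F + 2)\<close>, where \<open>c\<close> counts these points between \<open>F\<close> and \<open>n\<close>. The
  bounds \<open>1 \<le> J\<^sub>3 n \<le> n\<close> place \<open>2 * n + 1\<close> in the interval from \<open>2 / 3 * g n\<close> (excluded) to \<open>g n\<close>,
  which identifies \<open>c\<close> with the ceiling of the logarithm. At the next fixed point \<open>F'\<close> one has
  \<open>g F' = 2 * F' + 1\<close>, which eliminates \<open>3 * F + 2\<close>.\<close>

lemma josephus_3_after_fixed_point:
  assumes "1 \<le> F" "josephus 3 F = F"
  shows "josephus 3 (Suc F) = 2"
proof -
  have "josephus 3 (Suc F) = (1 + Suc F) mod Suc F + 1"
    using josephus_rec[of 3 "Suc F"] assms by simp
  also have "\<dots> = 2"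
    unfolding mod_add_self2 using assms by simp
  finally show ?thesis .
qed

text \<open>Since \<open>josephus 3 n < n\<close>, the sum \<open>josephus 3 n + 2\<close> is at
  most \<open>Suc n\<close>, so reduction modulo \<open>Suc n\<close> either gives 0 or changes
  nothing.\<close>

lemma josephus_3_step:
  assumes "1 \<le> n" "josephus 3 n \<noteq> n"
  shows "josephus 3 (Suc n) = (if josephus 3 n = n - 1 then 1 else josephus 3 n + 3)"
proof -
  have "josephus 3 (Suc n) = (josephus 3 n + 2) mod Suc n + 1"
    using josephus_rec[of 3 "Suc n"] assms by simp
  moreover have "josephus 3 n < n"
    using josephus_bounds[of 3 n] assms by simp
  ultimately show ?thesis
    by (cases "josephus 3 n = n - 1") simp_all
qed

lemma josephus_3_between_fixed_points:
  assumes "1 \<le> F" "josephus 3 F = F" "F < n"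
    and "\<And>x. F < x \<Longrightarrow> x < n \<Longrightarrow> josephus 3 x \<noteq> x"
  shows "3 * real n + 1 - real (josephus 3 n) =
    (3 / 2) ^ card {x \<in> pure_high_extremal_points 3. F < x \<and> x < n} * (3 * real F + 2)"
proof -
  \<comment> \<open>The induction starts at \<open>Suc F\<close>, because at \<open>F\<close> itself
    the left side is \<open>2 * F + 1\<close> instead of \<open>3 * F + 2\<close>.\<close>
  have "Suc F \<le> n" using assms(3) by simp
  then show ?thesis using assms(4)
  proof (induction n rule: dec_induct)
    case base
    have "{x \<in> pure_high_extremal_points 3. F < x \<and> x < Suc F} = {}" by auto
    then have "card {x \<in> pure_high_extremal_points 3. F < x \<and> x < Suc F} = 0"
      by (simp only: card.empty)
    then show ?case
      by (simp only: josephus_3_after_fixed_point[OF assms(1,2)]) simp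
  next
    case (step n)
    let ?P = "\<lambda>n. {x \<in> pure_high_extremal_points 3. F < x \<and> x < n}"
    have n: "1 \<le> n" "josephus 3 n \<noteq> n" using step by auto
    have IH: "3 * real n + 1 - real (josephus 3 n) = (3 / 2) ^ card (?P n) * (3 * real F + 2)"
      by (rule step.IH) (use step.prems in simp)
    show ?case
    proof (cases "josephus 3 n = n - 1")
      case True
      then have "?P (Suc n) = insert n (?P n)"
        using n step.hyps by (auto simp: pure_high_extremal_points_def)
      then have "card (?P (Suc n)) = Suc (card (?P n))" by simp
      \<comment> \<open>The left side is thus \<open>2 * n + 2\<close> at \<open>n\<close> and
        \<open>3 * n + 3\<close> at \<open>Suc n\<close>, which gives the factor 3/2.\<close>
      moreover have "real (josephus 3 n) = real n - 1" using True n by simp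
      ultimately show ?thesis
        using IH True josephus_3_step[OF n] by simp
    next
      case False
      then have "?P (Suc n) = ?P n"
        by (auto simp: pure_high_extremal_points_def less_Suc_eq)
      then show ?thesis
        using IH False josephus_3_step[OF n] by simp
    qed
  qed
qed

lemma fixed_point_seq_3:
  assumes "1 \<le> l"
  shows "fixed_point_seq 3 l \<in> fixed_points 3"
    and "\<lbrakk>fixed_point_seq 3 l < x; x < fixed_point_seq 3 (l + 1)\<rbrakk> \<Longrightarrow> x \<notin> fixed_points 3"
proof -
  obtain k where k: "l = Suc k" using assms by (cases l) auto
  note inf = infinite_fixed_points_3
  show "fixed_point_seq 3 l \<in> fixed_points 3"
    by (simp add: fixed_point_seq_def enumerate_in_set[OF inf])
  \<comment> \<open>The next enumerated value is the least fixed point above the current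
    one.\<close>
  show "x \<notin> fixed_points 3" if "fixed_point_seq 3 l < x" "x < fixed_point_seq 3 (l + 1)"
    using that not_less_Least[of x "\<lambda>s. s \<in> fixed_points 3 \<and> enumerate (fixed_points 3) k < s"]
    by (simp add: fixed_point_seq_def k enumerate_Suc''[OF inf] del: enumerate_Suc)
qed

theorem theorem4:
  fixes l n :: nat and m :: int
  assumes "1 \<le> l"
    and "fixed_point_seq 3 l + 1 \<le> n" and "n \<le> fixed_point_seq 3 (l + 1)"
    and "m = \<lceil>log (3 / 2) ((2 * real n + 1) / (3 * real (fixed_point_seq 3 l) + 2))\<rceil>"
  shows "real (josephus 3 n) =
    3 * real n + 1 - (2 / 3) powi (int (num_pure_high 3 l) - m)
      * (2 * real (fixed_point_seq 3 (l + 1)) + 1)"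
proof -
  define F where "F = fixed_point_seq 3 l"
  define F' where "F' = fixed_point_seq 3 (l + 1)"
  define c where "c n = card {x \<in> pure_high_extremal_points 3. F < x \<and> x < n}" for n
  define A where "A = 3 * real F + 2"
  have A: "A > 0" by (simp add: A_def)
  have F: "1 \<le> F" "josephus 3 F = F" and F': "josephus 3 F' = F'"
    using fixed_point_seq_3(1)[of l] fixed_point_seq_3(1)[of "l + 1"] assms(1)
    by (simp_all add: F_def F'_def fixed_points_def)
  have Fn: "F < n" "n \<le> F'" using assms(2,3) by (simp_all add: F_def F'_def)
  have nofix: "josephus 3 x \<noteq> x" if "F < x" "x < F'" for x
    using fixed_point_seq_3(2)[OF assms(1), of x] that
    by (simp add: F_def F'_def fixed_points_def)
  have g: "3 * real n + 1 - real (josephus 3 n) = (3 / 2) ^ c n * A"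
    unfolding c_def A_def
    by (rule josephus_3_between_fixed_points[OF F]) (use Fn nofix in auto)
  \<comment> \<open>Fixed points are excluded only strictly below the argument, so the formula still
    holds at \<open>F'\<close>.\<close>
  have "3 * real F' + 1 - real (josephus 3 F') = (3 / 2) ^ c F' * A"
    unfolding c_def A_def
    by (rule josephus_3_between_fixed_points[OF F]) (use Fn nofix in auto)
  then have g': "2 * real F' + 1 = (3 / 2) ^ c F' * A" by (simp add: F')
  have J: "1 \<le> real (josephus 3 n)" "real (josephus 3 n) \<le> real n"
    using josephus_bounds[of 3 n] Fn by simp_all
  define y where "y = (2 * real n + 1) / A"
  have y: "y > 0" using A by (simp add: y_def)
  \<comment> \<open>This is \<open>josephus 3 n \<le> n\<close>, in the form
    \<open>2 * n + 1 \<le> (3 / 2) ^ c n * A\<close>.\<close>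
  have "y \<le> (3 / 2) ^ c n"
    unfolding y_def using A g J by (subst pos_divide_le_eq) linarith+
  then have "log (3 / 2) y \<le> log (3 / 2) ((3 / 2) ^ c n)"
    using y by (subst log_le_cancel_iff) simp_all
  then have up: "log (3 / 2) y \<le> real (c n)"
    by (simp add: log_nat_power)
  \<comment> \<open>From \<open>1 \<le> josephus 3 n\<close> the product
    \<open>(3 / 2) ^ c n * A\<close> is at most \<open>3 * n\<close>, so the left side is at most
    \<open>2 * n\<close>.\<close>
  have "2 / 3 * ((3 / 2) ^ c n * A) < 2 * real n + 1"
    using g J by linarith
  then have "(3 / 2) ^ c n < 3 / 2 * y"
    using A by (simp add: y_def field_simps)
  then have "log (3 / 2) ((3 / 2) ^ c n) < log (3 / 2) (3 / 2 * y)"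
    using y by (subst log_less_cancel_iff) simp_all
  then have low: "real (c n) - 1 < log (3 / 2) y"
    using y log_mult_pos[of "3 / 2" y "3 / 2"] by (simp add: log_nat_power)
  have m: "m = int (c n)"
    unfolding assms(4) F_def[symmetric] A_def[symmetric] y_def[symmetric]
    by (rule ceiling_unique) (use up low in simp_all)
  have num: "num_pure_high 3 l = c F'"
    by (simp add: num_pure_high_def c_def F_def F'_def)
  have "(2 / 3 :: real) powi (int (c F') - int (c n)) = (3 / 2) ^ c n / (3 / 2) ^ c F'"
    by (simp add: power_int_diff power_divide field_simps)
  then have "(2 / 3) powi (int (c F') - int (c n)) * (2 * real F' + 1) = (3 / 2) ^ c n * A"
    by (simp add: g')
  then show ?thesis
    using g unfolding m num F'_def[symmetric] by linarith
qed

end
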